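(* Let $\Gamma$ be a countable, locally infinite, primitive graph. If $\Gamma$ has infinite diameter, then its distance sequence is $1,\aleph_0,\aleph_0,\dots$ (that is, $d(0)=1$ and $d(i)=\aleph_0$ for all $i\ge1$). If $\Gamma$ has finite diameter, then its distance sequence is $1,\aleph_0,\dots,\aleph_0,a$ for some cardinal $a$ with $2\le a\le\aleph_0$ (that is, if the diameter is $n$, then $d(0)=1$, $d(i)=\aleph_0$ for all $1\le i<n$, and $2\le d(n)\le\aleph_0$).
   Context: Graphs are simple and undirected, with vertex set $V(\Gamma)$. A graph is countable if its vertex set is countable, and locally infinite if its vertices have infinite degree. A graph $\Gamma$ is primitive if its automorphism group acts primitively on $V(\Gamma)$, i.e. the only equivalence relations on $V(\Gamma)$ invariant under $\mathrm{Aut}(\Gamma)$ are the trivial ones (equality and the universal relation). A graph is vertex-transitive if any vertex can be mapped to any other by an automorphism. For a vertex-transitive graph, the distance sequence is $d(0),d(1),d(2),\dots$, where $d(i)$ is the (cardinal) number of vertices at graph distance exactly $i$ from a fixed vertex $v$; it does not depend on $v$. If the diameter is finite, equal to $n$, the sequence is the finite list $d(0),\dots,d(n)$. Locally infinite primitive graphs are vertex-transitive and connected, so this notion applies; infinite diameter means that finite distances are unbounded. *)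

theory Defs
  imports
    "Graph_Theory.Pair_Digraph"
    "HOL-Library.Extended_Nat"
    "HOL-Library.Countable_Set"
begin

unbundle cardinal_syntax

text \<open>
  A simple undirected graph, possibly infinite, is a digraph satisfying
  \<^locale>\<open>pair_bidirected_digraph\<close>: the arcs are ordered pairs of vertices, and the arc
  relation is symmetric and irreflexive.
\<close>

definition graph_automorphism :: "'a pair_pre_digraph \<Rightarrow> ('a \<Rightarrow> 'a) \<Rightarrow> bool" where
  "graph_automorphism G f \<longleftrightarrow>
     bij_betw f (pverts G) (pverts G) \<and>
     (\<forall>u\<in>pverts G. \<forall>v\<in>pverts G. (u, v) \<in> parcs G \<longleftrightarrow> (f u, f v) \<in> parcs G)"

definition primitive_graph :: "'a pair_pre_digraph \<Rightarrow> bool" where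
  "primitive_graph G \<longleftrightarrow>
     (\<forall>R. equiv (pverts G) R \<and>
          (\<forall>f. graph_automorphism G f \<longrightarrow> (\<forall>(u, v)\<in>R. (f u, f v) \<in> R)) \<longrightarrow>
          R = Id_on (pverts G) \<or> R = pverts G \<times> pverts G)"

definition locally_infinite :: "'a pair_pre_digraph \<Rightarrow> bool" where
  "locally_infinite G \<longleftrightarrow> (\<forall>v\<in>pverts G. infinite {u \<in> pverts G. (v, u) \<in> parcs G})"

text \<open>The distance is \<open>\<infinity>\<close> if no walk joins the two vertices.\<close>

definition graph_dist :: "'a pair_pre_digraph \<Rightarrow> 'a \<Rightarrow> 'a \<Rightarrow> enat" where
  "graph_dist G u v = (INF p\<in>{p. pre_digraph.awalk (with_proj G) u p v}. enat (length p))"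

definition graph_diameter :: "'a pair_pre_digraph \<Rightarrow> enat" where
  "graph_diameter G = (SUP (u, v)\<in>pverts G \<times> pverts G. graph_dist G u v)"

text \<open>The distance sequence based at \<open>v\<close>; its terms are cardinals.\<close>

definition distance_seq :: "'a pair_pre_digraph \<Rightarrow> 'a \<Rightarrow> nat \<Rightarrow> 'a rel" where
  "distance_seq G v i = |{u \<in> pverts G. graph_dist G v u = enat i}|"

end

theory Submission
  imports Defs
begin

text \<open>
  Only the claim that the spheres \<open>S\<^sub>i\<close> with \<open>2 \<le> i < diameter\<close> are infinite needs an idea.
  Suppose all \<open>S\<^sub>i(v)\<close> are finite, and let \<open>w \<in> S\<^bsub>i+1\<^esub>(v)\<close>.  Let \<open>T\<close> be the finite union of some walks from
  \<open>v\<close> to each vertex of \<open>S\<^sub>i(v)\<close>.  As \<open>w\<close> has infinitely many neighbours, one of them, \<open>x\<close>, lies in no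
  \<open>S\<^sub>i(t)\<close> with \<open>t \<in> T\<close>.  Since \<open>d(v, x) \<in> {i, i+1, i+2}\<close>, we get \<open>i < d(v, x) \<le> 2i\<close>.  A geodesic
  from \<open>v\<close> to \<open>x\<close> meets \<open>S\<^sub>i(v)\<close> in a vertex \<open>y\<close> with \<open>d(y, x) \<le> i\<close>, so the walk in \<open>T\<close> from \<open>v\<close>
  to \<open>y\<close> passes through a vertex at distance exactly \<open>i\<close> from \<open>x\<close>, a contradiction.

  If the last sphere were a single point, then being equal or antipodal would be a
  nontrivial invariant equivalence relation.
\<close>

definition dist_sphere :: "'a pair_pre_digraph \<Rightarrow> 'a \<Rightarrow> nat \<Rightarrow> 'a set" where
  "dist_sphere G v i = {u \<in> pverts G. graph_dist G v u = enat i}"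

lemma distance_seq_eq_card_of: "distance_seq G v i = |dist_sphere G v i|"
  by (simp add: distance_seq_def dist_sphere_def)

subsection \<open>Graph distance\<close>

context pair_wf_digraph
begin

text \<open>Powers of the arc relation replace walks from here on, since they compose, reverse and
  map under automorphisms more simply.\<close>

lemma awalk_imp_relpow: "awalk u p v \<Longrightarrow> (u, v) \<in> parcs G ^^ length p"
proof (induction p arbitrary: u)
  case (Cons e p)
  then have "(u, snd e) \<in> parcs G" "(snd e, v) \<in> parcs G ^^ length p"
    by (cases e; simp add: awalk_simps)+
  then show ?case unfolding list.size(4) add_Suc_right add_0_right by (rule relpow_Suc_I2)
qed (simp add: awalk_simps)

text \<open>The zeroth power relates every element of the type to itself, while an empty walk must
  sit at a vertex; hence the hypothesis on \<open>u\<close>.\<close>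

lemma relpow_imp_awalk:
  "(u, v) \<in> parcs G ^^ k \<Longrightarrow> u \<in> pverts G \<Longrightarrow> \<exists>p. awalk u p v \<and> length p = k"
proof (induction k arbitrary: u)
  case 0
  then show ?case by (auto simp: awalk_simps)
next
  case (Suc k)
  then obtain w where w: "(u, w) \<in> parcs G" "(w, v) \<in> parcs G ^^ k"
    by (meson relpow_Suc_D2)
  then obtain p where "awalk w p v" "length p = k"
    using Suc.IH in_arcsD2 by blast
  with w have "awalk u ((u, w) # p) v" "length ((u, w) # p) = Suc k"
    by (auto simp: awalk_simps)
  then show ?case by blast
qed

lemma relpow_in_verts: "(u, v) \<in> parcs G ^^ k \<Longrightarrow> u \<in> pverts G \<Longrightarrow> v \<in> pverts G"
  by (induction k arbitrary: v) (auto dest: in_arcsD2)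

lemma graph_dist_le: "(u, v) \<in> parcs G ^^ k \<Longrightarrow> u \<in> pverts G \<Longrightarrow> graph_dist G u v \<le> enat k"
  unfolding graph_dist_def by (metis (mono_tags) INF_lower mem_Collect_eq relpow_imp_awalk)

text \<open>A finite infimum is attained because \<open>enat\<close> is well-ordered; an empty set
  of walks would give infinity.\<close>

lemma graph_dist_enatD:
  assumes "graph_dist G u v = enat k"
  shows "(u, v) \<in> parcs G ^^ k"
proof -
  let ?S = "(\<lambda>p. enat (length p)) ` {p. awalk u p v}"
  have "?S \<noteq> {}"
  proof
    assume "?S = {}"
    then have "graph_dist G u v = Inf {}" unfolding graph_dist_def by (rule arg_cong)
    with assms show False by (simp add: top_enat_def)
  qed
  then have "Inf ?S \<in> ?S"
    by (meson ex_in_conv wellorder_InfI)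
  then show ?thesis
    using assms unfolding graph_dist_def by (auto dest: awalk_imp_relpow)
qed

text \<open>Symmetry and invariance under automorphisms both follow by using this in two
  directions.\<close>

lemma graph_dist_mono_transfer:
  assumes "u' \<in> pverts G"
    and "\<And>k. (u, v) \<in> parcs G ^^ k \<Longrightarrow> (u', v') \<in> parcs G ^^ k"
  shows "graph_dist G u' v' \<le> graph_dist G u v"
proof (cases "graph_dist G u v")
  case (enat k)
  then show ?thesis using assms graph_dist_enatD graph_dist_le by metis
qed simp

lemma graph_dist_refl: "v \<in> pverts G \<Longrightarrow> graph_dist G v v = 0"
  using graph_dist_le[of v v 0] by (simp add: zero_enat_def[symmetric])

lemma graph_dist_0D: "graph_dist G u v = 0 \<Longrightarrow> u = v"
  using graph_dist_enatD[of u v 0] by (simp add: zero_enat_def)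

lemma dist_sphere_0: "v \<in> pverts G \<Longrightarrow> dist_sphere G v 0 = {v}"
  using graph_dist_refl graph_dist_0D by (auto simp: dist_sphere_def zero_enat_def[symmetric])

lemma graph_dist_triangle:
  assumes "u \<in> pverts G"
  shows "graph_dist G u w \<le> graph_dist G u v + graph_dist G v w"
proof (cases "graph_dist G u v"; cases "graph_dist G v w")
  fix j k assume jk: "graph_dist G u v = enat j" "graph_dist G v w = enat k"
  then have "(u, w) \<in> parcs G ^^ (j + k)"
    by (auto simp: relpow_add dest: graph_dist_enatD)
  then show ?thesis using graph_dist_le assms jk by fastforce
qed auto

lemma graph_dist_arc: "(u, v) \<in> parcs G \<Longrightarrow> graph_dist G u v \<le> 1"
  using graph_dist_le[of u v 1] in_arcsD1 by (simp add: one_enat_def)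

text \<open>Cut a geodesic after \<open>j\<close> arcs: neither piece can be shortened, as the
  triangle inequality would then shorten the whole.\<close>

lemma graph_dist_split:
  assumes "graph_dist G u w = enat (j + k)" "u \<in> pverts G"
  shows "\<exists>v\<in>pverts G. graph_dist G u v = enat j \<and> graph_dist G v w = enat k"
proof -
  obtain v where v: "(u, v) \<in> parcs G ^^ j" "(v, w) \<in> parcs G ^^ k"
    using graph_dist_enatD[OF assms(1)] by (auto simp: relpow_add)
  have V: "v \<in> pverts G" using v(1) assms(2) by (rule relpow_in_verts)
  have le: "graph_dist G u v \<le> enat j" "graph_dist G v w \<le> enat k"
    using v V assms(2) graph_dist_le by auto
  then obtain j' k' where jk': "graph_dist G u v = enat j'" "graph_dist G v w = enat k'"
    by (metis enat_ile)
  with graph_dist_triangle[OF assms(2), of w v] assms(1) le have "j' = j" "k' = k"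
    by auto
  with jk' V show ?thesis by auto
qed

text \<open>Discrete intermediate value theorem, with the vertices \<open>T\<close> of the walk chosen before \<open>x\<close>.\<close>

lemma finite_walk_meets_spheres:
  assumes "(v, y) \<in> parcs G ^^ m" "v \<in> pverts G"
  shows "\<exists>T. finite T \<and> T \<subseteq> pverts G \<and>
           (\<forall>x i. enat i < graph_dist G v x \<longrightarrow> graph_dist G y x \<le> enat i \<longrightarrow>
              (\<exists>t\<in>T. graph_dist G t x = enat i))"
  using assms
proof (induction m arbitrary: y)
  case 0
  \<comment> \<open>Here \<open>y = v\<close>, so the two premises on \<open>x\<close> contradict
    each other and the empty set serves.\<close>
  then show ?case by (intro exI[of _ "{}"]) auto
next
  case (Suc m)
  then obtain z where z: "(v, z) \<in> parcs G ^^ m" "(z, y) \<in> parcs G" by auto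
  with Suc obtain T where T: "finite T" "T \<subseteq> pverts G"
    "\<And>x i. enat i < graph_dist G v x \<Longrightarrow> graph_dist G z x \<le> enat i \<Longrightarrow>
       \<exists>t\<in>T. graph_dist G t x = enat i" by meson
  have "\<exists>t\<in>insert y T. graph_dist G t x = enat i"
    if x: "enat i < graph_dist G v x" "graph_dist G y x \<le> enat i" for x i
  proof (cases "graph_dist G z x \<le> enat i")
    case True
    then show ?thesis using T(3) x by blast
  next
    case False
    \<comment> \<open>Along the arc from \<open>z\<close> to \<open>y\<close> the distance to
      \<open>x\<close> falls by at most one, so dropping from above \<open>i\<close> to at most
      \<open>i\<close> lands exactly on \<open>i\<close>.\<close>
    have "graph_dist G z x \<le> graph_dist G z y + graph_dist G y x"
      using graph_dist_triangle in_arcsD1 z(2) by blast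
    also have "\<dots> \<le> 1 + graph_dist G y x"
      using graph_dist_arc[OF z(2)] by (rule add_right_mono)
    finally have "enat i < 1 + graph_dist G y x" using False by (meson not_le order_less_le_trans)
    moreover obtain k where "graph_dist G y x = enat k" "k \<le> i"
      using x(2) by (metis enat_ile enat_ord_simps(1))
    ultimately have "graph_dist G y x = enat i" by (simp add: one_enat_def)
    then show ?thesis by auto
  qed
  moreover have "finite (insert y T)" "insert y T \<subseteq> pverts G"
    using T(1,2) z(2) in_arcsD2 by auto
  ultimately show ?case by blast
qed

end

section \<open>Consequences of finite spheres in symmetric digraphs\<close>

context pair_sym_digraph
begin

lemma relpow_arcs_sym: "(u, v) \<in> parcs G ^^ k \<Longrightarrow> (v, u) \<in> parcs G ^^ k"
proof (induction k arbitrary: v)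
  case (Suc k)
  then show ?case by (meson arcs_symmetric relpow_Suc_E relpow_Suc_I2)
qed simp

lemma graph_dist_sym:
  "u \<in> pverts G \<Longrightarrow> v \<in> pverts G \<Longrightarrow> graph_dist G u v = graph_dist G v u"
  by (intro antisym graph_dist_mono_transfer) (auto intro: relpow_arcs_sym)

lemma next_sphere_empty:
  assumes inf: "locally_infinite G"
    and i: "2 \<le> i"
    and fin: "\<And>v. v \<in> pverts G \<Longrightarrow> finite (dist_sphere G v i)"
    and v: "v \<in> pverts G"
  shows "dist_sphere G v (Suc i) = {}"
proof (rule ccontr)
  assume "dist_sphere G v (Suc i) \<noteq> {}"
  then obtain w where w: "w \<in> pverts G" "graph_dist G v w = enat (Suc i)"
    by (auto simp: dist_sphere_def)
  have "\<exists>T. finite T \<and> T \<subseteq> pverts G \<and>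
           (\<forall>x i. enat i < graph_dist G v x \<longrightarrow> graph_dist G y x \<le> enat i \<longrightarrow>
              (\<exists>t\<in>T. graph_dist G t x = enat i))" if "y \<in> dist_sphere G v i" for y
  proof (rule finite_walk_meets_spheres)
    show "(v, y) \<in> parcs G ^^ i" using that graph_dist_enatD by (simp add: dist_sphere_def)
  qed (rule v)
  then obtain T where T: "\<And>y. y \<in> dist_sphere G v i \<Longrightarrow> finite (T y)"
    "\<And>y. y \<in> dist_sphere G v i \<Longrightarrow> T y \<subseteq> pverts G"
    "\<And>y x j. y \<in> dist_sphere G v i \<Longrightarrow> enat j < graph_dist G v x \<Longrightarrow> graph_dist G y x \<le> enat j \<Longrightarrow>
        \<exists>t\<in>T y. graph_dist G t x = enat j"
    by metis
  \<comment> \<open>Including \<open>v\<close> itself rules out that \<open>x\<close> has distance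
    \<open>i\<close> from \<open>v\<close>. The sets \<open>T y\<close> do not depend on
    \<open>x\<close>, so \<open>U\<close> is fixed before \<open>x\<close> is chosen.\<close>
  define U where "U = insert v (\<Union>y\<in>dist_sphere G v i. T y)"
  have "finite U" "U \<subseteq> pverts G"
    unfolding U_def using fin v T(1,2) by auto
  then have "finite (\<Union>t\<in>U. dist_sphere G t i)" using fin by blast
  moreover have "infinite {x \<in> pverts G. (w, x) \<in> parcs G}"
    using inf w by (auto simp: locally_infinite_def)
  ultimately have "\<not> {x \<in> pverts G. (w, x) \<in> parcs G} \<subseteq> (\<Union>t\<in>U. dist_sphere G t i)"
    using finite_subset by blast
  then obtain x where x: "x \<in> pverts G" "(w, x) \<in> parcs G"
    "\<And>t. t \<in> U \<Longrightarrow> graph_dist G t x \<noteq> enat i"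
    by (auto simp: dist_sphere_def)
  have wx: "graph_dist G w x \<le> 1" "graph_dist G x w \<le> 1"
    using x(2) graph_dist_arc arcs_symmetric by auto
  have "graph_dist G v x \<le> graph_dist G v w + graph_dist G w x"
    using graph_dist_triangle v by blast
  also have "\<dots> \<le> enat (Suc i) + 1" using w(2) wx(1) add_mono by fastforce
  finally obtain d where d: "graph_dist G v x = enat d" "d \<le> i + 2"
    by (cases "graph_dist G v x") (auto simp: one_enat_def)
  have "enat (Suc i) \<le> graph_dist G v x + graph_dist G x w"
    using graph_dist_triangle[OF v, of w x] w(2) by simp
  also have "\<dots> \<le> enat d + 1" using d(1) wx(2) add_mono by fastforce
  finally have "i \<le> d" by (simp add: one_enat_def)
  moreover have "d \<noteq> i" using x(3)[of v] d(1) by (auto simp: U_def)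
  \<comment> \<open>This is where \<open>2 \<le> i\<close> enters: \<open>d \<le> i + 2\<close>
    gives \<open>d - i \<le> 2 \<le> i\<close>, so the end \<open>y\<close> of the walk is close
    enough to \<open>x\<close>.\<close>
  ultimately have d': "i < d" "d - i \<le> i" using d(2) i by auto
  then obtain y where y: "y \<in> dist_sphere G v i" "graph_dist G y x = enat (d - i)"
    using graph_dist_split[of v x i "d - i"] d(1) v by (auto simp: dist_sphere_def)
  with T(3)[of y i x] d d' obtain t where "t \<in> T y" "graph_dist G t x = enat i" by auto
  with y x(3)[of t] show False by (auto simp: U_def)
qed

end

subsection \<open>Automorphisms\<close>

lemma graph_automorphism_comp:
  "graph_automorphism G f \<Longrightarrow> graph_automorphism G g \<Longrightarrow> graph_automorphism G (g \<circ> f)"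
  unfolding graph_automorphism_def by (metis bij_betw_trans bij_betw_apply comp_apply)

text \<open>Automorphisms are constrained only on vertices and arbitrary elsewhere, so the inverse
  is taken relative to \<open>pverts G\<close>.\<close>

lemma graph_automorphism_inv:
  assumes "graph_automorphism G f"
  shows "graph_automorphism G (inv_into (pverts G) f)"
proof -
  have bij: "bij_betw f (pverts G) (pverts G)"
    using assms by (simp add: graph_automorphism_def)
  then have "bij_betw (inv_into (pverts G) f) (pverts G) (pverts G)"
    by (rule bij_betw_inv_into)
  then show ?thesis
    using assms bij unfolding graph_automorphism_def
    by (auto simp: bij_betw_inv_into_right dest: bij_betwE)
qed

lemma graph_automorphism_in_verts: "graph_automorphism G f \<Longrightarrow> v \<in> pverts G \<Longrightarrow> f v \<in> pverts G"
  by (auto simp: graph_automorphism_def dest: bij_betwE)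

lemma graph_automorphism_inv_apply:
  "graph_automorphism G f \<Longrightarrow> v \<in> pverts G \<Longrightarrow> inv_into (pverts G) f (f v) = v"
  unfolding graph_automorphism_def by (elim conjE) (rule bij_betw_inv_into_left)

context pair_wf_digraph
begin

lemma relpow_automorphism:
  assumes "graph_automorphism G f" "u \<in> pverts G" "(u, v) \<in> parcs G ^^ k"
  shows "(f u, f v) \<in> parcs G ^^ k"
  using assms(3)
proof (induction k arbitrary: v)
  case (Suc k)
  then obtain w where w: "(u, w) \<in> parcs G ^^ k" "(w, v) \<in> parcs G" by auto
  then have "(f w, f v) \<in> parcs G"
    using assms(1) in_arcsD1[OF w(2)] in_arcsD2[OF w(2)] by (simp add: graph_automorphism_def)
  with Suc.IH[OF w(1)] show ?case by auto
qed auto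

lemma graph_dist_automorphism:
  assumes f: "graph_automorphism G f" and uv: "u \<in> pverts G" "v \<in> pverts G"
  shows "graph_dist G (f u) (f v) = graph_dist G u v"
proof -
  have le: "graph_dist G (g a) (g b) \<le> graph_dist G a b"
    if "graph_automorphism G g" "a \<in> pverts G" for g a b
    using that relpow_automorphism graph_automorphism_in_verts
    by (intro graph_dist_mono_transfer) auto
  \<comment> \<open>Automorphisms never increase distances; \<open>f\<close> and its inverse give
    the two inequalities.\<close>
  show ?thesis
    using le[OF f uv(1), of v]
      le[OF graph_automorphism_inv[OF f] graph_automorphism_in_verts[OF f uv(1)], of "f v"]
    by (simp add: graph_automorphism_inv_apply f uv)
qed

lemma dist_sphere_automorphism:
  assumes "graph_automorphism G f" "v \<in> pverts G"
  shows "bij_betw f (dist_sphere G v i) (dist_sphere G (f v) i)"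
proof -
  have bij: "bij_betw f (pverts G) (pverts G)"
    using assms(1) by (simp add: graph_automorphism_def)
  moreover have "f ` dist_sphere G v i = dist_sphere G (f v) i"
  proof (intro equalityI subsetI)
    fix y assume "y \<in> dist_sphere G (f v) i"
    moreover from this obtain x where "x \<in> pverts G" "y = f x"
      using bij by (auto simp: dist_sphere_def bij_betw_def)
    ultimately show "y \<in> f ` dist_sphere G v i"
      using assms graph_dist_automorphism by (auto simp: dist_sphere_def)
  qed (use assms graph_dist_automorphism graph_automorphism_in_verts in
      \<open>auto simp: dist_sphere_def\<close>)
  ultimately show ?thesis
    by (auto simp: bij_betw_def dist_sphere_def intro: inj_on_subset)
qed

end

subsection \<open>Primitive graphs\<close>

lemma primitive_graphD:
  assumes "primitive_graph G" "equiv (pverts G) R"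
    and "\<And>f u v. graph_automorphism G f \<Longrightarrow> (u, v) \<in> R \<Longrightarrow> (f u, f v) \<in> R"
  shows "R = Id_on (pverts G) \<or> R = pverts G \<times> pverts G"
proof -
  have "\<forall>f. graph_automorphism G f \<longrightarrow> (\<forall>(u, v)\<in>R. (f u, f v) \<in> R)"
    using assms(3) by auto
  then show ?thesis
    using assms(1,2) unfolding primitive_graph_def by simp
qed

text \<open>The orbit relation is an invariant equivalence, so it is equality or universal.
  Infinitude supplies three distinct vertices, which is what excludes equality.\<close>

lemma primitive_graph_transitive:
  assumes prim: "primitive_graph G" and inf: "infinite (pverts G)"
    and uv: "u \<in> pverts G" "v \<in> pverts G"
  obtains f where "graph_automorphism G f" "f u = v"
proof -
  define R where "R = {(u, v). u \<in> pverts G \<and> v \<in> pverts G \<and> (\<exists>f. graph_automorphism G f \<and> f u = v)}"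
  have "equiv (pverts G) R"
  proof (rule equivI)
    show "R \<subseteq> pverts G \<times> pverts G" by (auto simp: R_def)
    have "graph_automorphism G id" by (simp add: graph_automorphism_def)
    then show "refl_on (pverts G) R" unfolding R_def by (force intro: refl_onI)
    show "sym R"
      unfolding R_def
      by (auto intro!: symI intro: graph_automorphism_inv graph_automorphism_inv_apply)
    show "trans R"
    proof (rule transI)
      fix a b c assume "(a, b) \<in> R" "(b, c) \<in> R"
      then obtain f g where "graph_automorphism G f" "f a = b" "graph_automorphism G g" "g b = c"
        and V: "a \<in> pverts G" "c \<in> pverts G"
        unfolding R_def by blast
      then have "graph_automorphism G (g \<circ> f)" "(g \<circ> f) a = c"
        using graph_automorphism_comp by auto
      with V show "(a, c) \<in> R" unfolding R_def by blast
    qed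
  qed
  moreover have "(g a, g b) \<in> R" if g: "graph_automorphism G g" and ab: "(a, b) \<in> R" for g a b
  proof -
    obtain f where f: "graph_automorphism G f" "f a = b"
      and V: "a \<in> pverts G" "b \<in> pverts G" using ab unfolding R_def by blast
    \<comment> \<open>The conjugate of \<open>f\<close> by \<open>g\<close> carries
      \<open>g a\<close> to \<open>g b\<close>.\<close>
    let ?h = "g \<circ> (f \<circ> inv_into (pverts G) g)"
    have "graph_automorphism G ?h"
      using f g by (intro graph_automorphism_comp graph_automorphism_inv)
    moreover have "?h (g a) = g b"
      using f g V by (simp add: graph_automorphism_inv_apply)
    ultimately have "\<exists>h. graph_automorphism G h \<and> h (g a) = g b" by blast
    then show ?thesis
      using V graph_automorphism_in_verts[OF g] by (simp add: R_def)
  qed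
  ultimately have "R = Id_on (pverts G) \<or> R = pverts G \<times> pverts G"
    using primitive_graphD[OF prim] by blast
  moreover have "R \<noteq> Id_on (pverts G)"
  proof
    text \<open>If all automorphisms are trivial, then every equivalence relation is invariant.\<close>
    assume R: "R = Id_on (pverts G)"
    have triv: "f a = a" if "graph_automorphism G f" "a \<in> pverts G" for f a
    proof -
      have "(a, f a) \<in> R" using that graph_automorphism_in_verts[OF that] by (auto simp: R_def)
      with R show ?thesis by auto
    qed
    obtain a where a: "a \<in> pverts G" using infinite_imp_nonempty[OF inf] by blast
    have "pverts G - {a} \<noteq> {}" "pverts G - {a, b} \<noteq> {}" for b
      using inf by (intro infinite_imp_nonempty; simp)+
    then obtain b c where b: "b \<in> pverts G" "b \<noteq> a" and c: "c \<in> pverts G" "c \<noteq> a" "c \<noteq> b"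
      by blast
    \<comment> \<open>Merging only \<open>a\<close> and \<open>b\<close> gives more than equality,
      and the third vertex \<open>c\<close> keeps it from being universal.\<close>
    let ?Q = "Id_on (pverts G) \<union> {a, b} \<times> {a, b}"
    have "equiv (pverts G) ?Q"
      using a b by (intro equivI refl_onI symI transI) auto
    moreover have "(f x, f y) \<in> ?Q" if "graph_automorphism G f" "(x, y) \<in> ?Q" for f x y
    proof -
      have "x \<in> pverts G" "y \<in> pverts G" using that(2) a b by auto
      then have "f x = x" "f y = y" using that(1) triv by auto
      then show ?thesis using that(2) by simp
    qed
    ultimately have "?Q = Id_on (pverts G) \<or> ?Q = pverts G \<times> pverts G"
      using primitive_graphD[OF prim] by blast
    moreover have "(a, b) \<in> ?Q" "(a, b) \<notin> Id_on (pverts G)" using b by auto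
    moreover have "(a, c) \<notin> ?Q" using c by auto
    ultimately show False using a c by blast
  qed
  ultimately have "(u, v) \<in> R" using uv by auto
  then show ?thesis using that unfolding R_def by blast
qed

section \<open>Connectedness and spheres of primitive graphs\<close>

context pair_bidirected_digraph
begin

text \<open>Lying at finite distance is an invariant equivalence relation, and the arc keeps it from
  being equality.\<close>

lemma primitive_graph_connected:
  assumes prim: "primitive_graph G"
    and arc: "(a, b) \<in> parcs G"
    and uv: "u \<in> pverts G" "v \<in> pverts G"
  shows "graph_dist G u v \<noteq> \<infinity>"
proof -
  define R where "R = {(u, v). u \<in> pverts G \<and> v \<in> pverts G \<and> graph_dist G u v \<noteq> \<infinity>}"
  have "equiv (pverts G) R"
  proof (rule equivI)
    show "R \<subseteq> pverts G \<times> pverts G" by (auto simp: R_def)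
    show "refl_on (pverts G) R" by (rule refl_onI) (simp add: R_def graph_dist_refl zero_enat_def)
    show "sym R" by (auto simp: R_def graph_dist_sym intro!: symI)
    show "trans R"
    proof (rule transI)
      fix x y z assume R: "(x, y) \<in> R" "(y, z) \<in> R"
      then have "graph_dist G x z \<le> graph_dist G x y + graph_dist G y z"
        by (intro graph_dist_triangle) (simp add: R_def)
      also have "\<dots> < \<infinity>" using R by (auto simp: R_def)
      finally show "(x, z) \<in> R" using R by (simp add: R_def)
    qed
  qed
  moreover have "(f x, f y) \<in> R" if "graph_automorphism G f" "(x, y) \<in> R" for f x y
    using that by (auto simp: R_def graph_dist_automorphism graph_automorphism_in_verts)
  ultimately have "R = Id_on (pverts G) \<or> R = pverts G \<times> pverts G"
    using primitive_graphD[OF prim] by blast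
  moreover have "(a, b) \<in> R"
    using graph_dist_arc[OF arc] in_arcsD1[OF arc] in_arcsD2[OF arc]
    by (auto simp: R_def one_enat_def dest: enat_ile)
  moreover have "a \<noteq> b" using pair_no_loops[OF arc] by simp
  ultimately have "R = pverts G \<times> pverts G" by auto
  then have "(u, v) \<in> R" using uv by simp
  then show ?thesis by (simp add: R_def)
qed

text \<open>By transitivity all spheres of radius \<open>n\<close> would be points, so each vertex
  would have a unique partner at distance \<open>n\<close>. These pairs would be the classes of an
  invariant equivalence relation, which on an infinite set is neither equality nor
  universal.\<close>

lemma primitive_graph_sphere_not_singleton:
  assumes prim: "primitive_graph G" and inf: "infinite (pverts G)" and n: "n > 0"
    and v: "v \<in> pverts G"
  shows "dist_sphere G v n \<noteq> {w}"
proof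
  assume w: "dist_sphere G v n = {w}"
  have uniq: "y = z"
    if V: "x \<in> pverts G" "y \<in> pverts G" "z \<in> pverts G"
      and d: "graph_dist G x y = enat n" "graph_dist G x z = enat n" for x y z
  proof -
    obtain f where f: "graph_automorphism G f" "f v = x"
      using primitive_graph_transitive[OF prim inf v V(1)] by blast
    then have "dist_sphere G x n = f ` {w}"
      using dist_sphere_automorphism[OF f(1) v, of n] w by (simp add: bij_betw_def)
    moreover have "y \<in> dist_sphere G x n" "z \<in> dist_sphere G x n"
      using V d by (simp_all add: dist_sphere_def)
    ultimately show ?thesis by simp
  qed
  define R where "R = {(x, y). x \<in> pverts G \<and> y \<in> pverts G \<and> (x = y \<or> graph_dist G x y = enat n)}"
  have "equiv (pverts G) R"
  proof (rule equivI)
    show "R \<subseteq> pverts G \<times> pverts G" by (auto simp: R_def)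
    show "refl_on (pverts G) R" by (rule refl_onI) (simp add: R_def)
    show "sym R" by (auto simp: R_def graph_dist_sym intro!: symI)
    show "trans R"
    proof (rule transI)
      \<comment> \<open>If both steps are nontrivial, \<open>x\<close> and \<open>z\<close> are
        partners of \<open>y\<close> and hence equal.\<close>
      fix x y z assume "(x, y) \<in> R" "(y, z) \<in> R"
      then show "(x, z) \<in> R"
        using uniq[of y x z] graph_dist_sym[of x y] unfolding R_def by auto
    qed
  qed
  moreover have "(f x, f y) \<in> R" if "graph_automorphism G f" "(x, y) \<in> R" for f x y
    using that by (auto simp: R_def graph_dist_automorphism graph_automorphism_in_verts)
  ultimately have R: "R = Id_on (pverts G) \<or> R = pverts G \<times> pverts G"
    using primitive_graphD[OF prim] by blast
  have vw: "w \<in> pverts G" "graph_dist G v w = enat n"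
    using w by (auto simp: dist_sphere_def)
  then have "(v, w) \<in> R" "v \<noteq> w"
    using v n graph_dist_refl by (auto simp: R_def zero_enat_def)
  with R have full: "R = pverts G \<times> pverts G" by auto
  have "pverts G - {v, w} \<noteq> {}"
    using inf by (intro infinite_imp_nonempty) simp
  then obtain x where x: "x \<in> pverts G" "x \<noteq> v" "x \<noteq> w" by blast
  then have "(v, x) \<in> R" using full v by simp
  then show False using uniq[OF v vw(1) x(1)] vw(2) x by (auto simp: R_def)
qed

text \<open>The first sphere contains all neighbours of \<open>v\<close>. For larger
  \<open>i\<close>, transitivity spreads finiteness from one sphere of radius \<open>i\<close> to
  all, so every next sphere is empty; a pair of vertices more than \<open>i\<close> apart
  contradicts this.\<close>

lemma primitive_graph_sphere_infinite:
  assumes prim: "primitive_graph G" and linf: "locally_infinite G"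
    and i: "1 \<le> i" "enat i < graph_diameter G"
    and v: "v \<in> pverts G"
  shows "infinite (dist_sphere G v i)"
proof
  assume fin: "finite (dist_sphere G v i)"
  have infn: "infinite {u \<in> pverts G. (v, u) \<in> parcs G}"
    using linf v by (simp add: locally_infinite_def)
  then have inf: "infinite (pverts G)" by auto
  have "{u \<in> pverts G. (v, u) \<in> parcs G} \<subseteq> dist_sphere G v 1"
  proof
    fix u assume "u \<in> {u \<in> pverts G. (v, u) \<in> parcs G}"
    then have u: "u \<in> pverts G" "(v, u) \<in> parcs G" by auto
    then have "graph_dist G v u \<noteq> 0" using graph_dist_0D pair_no_loops by fastforce
    with graph_dist_arc[OF u(2)] have "graph_dist G v u = 1"
      by (simp add: order_antisym ileI1 one_eSuc)
    with u(1) show "u \<in> dist_sphere G v 1" by (simp add: dist_sphere_def one_enat_def)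
  qed
  with infn fin have "i \<noteq> 1" using finite_subset by blast
  with i have i2: "2 \<le> i" by simp
  have fin': "finite (dist_sphere G x i)" if x: "x \<in> pverts G" for x
  proof -
    obtain f where "graph_automorphism G f" "f v = x"
      using primitive_graph_transitive[OF prim inf v x] by blast
    then show ?thesis using fin dist_sphere_automorphism[of f v i] v bij_betw_finite by blast
  qed
  obtain x y where xy: "x \<in> pverts G" "y \<in> pverts G" "enat i < graph_dist G x y"
    using i(2) by (auto simp: graph_diameter_def less_SUP_iff)
  obtain b where "(v, b) \<in> parcs G" using infn by (metis (mono_tags) Collect_empty_eq finite.emptyI)
  then have "graph_dist G x y \<noteq> \<infinity>" using primitive_graph_connected[OF prim] xy by blast
  then obtain d where d: "graph_dist G x y = enat d" "Suc i \<le> d" using xy(3) by auto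
  \<comment> \<open>A geodesic from \<open>x\<close> to \<open>y\<close> passes through the sphere
    of radius \<open>Suc i\<close>.\<close>
  then have "graph_dist G x y = enat (Suc i + (d - Suc i))" by simp
  from graph_dist_split[OF this xy(1)] have "dist_sphere G x (Suc i) \<noteq> {}"
    by (auto simp: dist_sphere_def)
  then show False using next_sphere_empty[OF linf i2 fin' xy(1)] by blast
qed

end

section \<open>Cardinals of the distance sequence\<close>

lemma countable_infinite_card_of: "countable A \<Longrightarrow> infinite A \<Longrightarrow> |A| =o natLeq"
  by (rule ordIso_transitive[OF card_of_ordIsoI[OF to_nat_on_infinite] card_of_nat])

theorem theorem1p10:
  fixes G :: "'a pair_pre_digraph"
  assumes "pair_bidirected_digraph G"
    and "countable (pverts G)"
    and "locally_infinite G"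
    and "primitive_graph G"
  shows "(graph_diameter G = \<infinity> \<longrightarrow>
            (\<forall>v\<in>pverts G.
               distance_seq G v 0 =o cone \<and>
               (\<forall>i\<ge>1. distance_seq G v i =o natLeq))) \<and>
         (\<forall>n. graph_diameter G = enat n \<longrightarrow>
            (\<exists>a :: nat rel. Card_order a \<and> ctwo \<le>o a \<and> a \<le>o natLeq \<and>
               (\<forall>v\<in>pverts G.
                  distance_seq G v 0 =o cone \<and>
                  (\<forall>i. 1 \<le> i \<and> i < n \<longrightarrow> distance_seq G v i =o natLeq) \<and>
                  distance_seq G v n =o a)))"
proof -
  interpret pair_bidirected_digraph G by (fact assms(1))
  have zero: "distance_seq G v 0 =o cone" if "v \<in> pverts G" for v
    using that card_of_ordIsoI[of "\<lambda>_. ()" "{v}" "{()}"]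
    by (simp add: distance_seq_eq_card_of dist_sphere_0 cone_def bij_betw_def)
  have countable: "countable (dist_sphere G v i)" for v i
    using assms(2) by (rule countable_subset[rotated]) (auto simp: dist_sphere_def)
  have mid: "distance_seq G v i =o natLeq"
    if "v \<in> pverts G" "1 \<le> i" "enat i < graph_diameter G" for v i
    unfolding distance_seq_eq_card_of using that assms(3,4) countable
    by (intro countable_infinite_card_of primitive_graph_sphere_infinite)
  have last: "\<exists>a :: nat rel. Card_order a \<and> ctwo \<le>o a \<and> a \<le>o natLeq \<and>
               (\<forall>v\<in>pverts G. distance_seq G v n =o a)"
    if n: "graph_diameter G = enat n" for n
  proof (cases "pverts G = {}")
    case True
    \<comment> \<open>Without vertices the condition on base points is vacuous, so any admissible
      cardinal will do; \<open>natLeq\<close> is taken.\<close>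
    then show ?thesis
      by (intro exI[of _ natLeq])
        (simp add: natLeq_Card_order ordLess_imp_ordLeq[OF ctwo_ordLess_natLeq] ordLeq_reflexive natLeq_Well_order)
  next
    case False
    then obtain v where v: "v \<in> pverts G" by auto
    have "infinite {u \<in> pverts G. (v, u) \<in> parcs G}"
      using assms(3) v by (simp add: locally_infinite_def)
    then have inf: "infinite (pverts G)" and "\<exists>b. (v, b) \<in> parcs G"
      by (auto dest: not_finite_existsD)
    then obtain b where b: "(v, b) \<in> parcs G" by blast
    have n0: "n > 0"
    proof -
      have "graph_dist G v b \<le> graph_diameter G"
        unfolding graph_diameter_def using v in_arcsD2[OF b] by (auto intro!: SUP_upper2[of "(v, b)"])
      moreover have "graph_dist G v b \<noteq> 0"
        using graph_dist_0D pair_no_loops[OF b] by fastforce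
      ultimately show ?thesis using n by (cases n) (auto simp: zero_enat_def[symmetric])
    qed
    have "dist_sphere G v n \<noteq> {}"
    proof -
      \<comment> \<open>The supremum is attained: a pair further apart than \<open>n - 1\<close> is
        at distance exactly \<open>n\<close>, and an automorphism moves its first vertex to
        \<open>v\<close>.\<close>
      have "enat (n - 1) < graph_diameter G" using n n0 by simp
      then obtain x y where xy: "x \<in> pverts G" "y \<in> pverts G" "enat (n - 1) < graph_dist G x y"
        by (auto simp: graph_diameter_def less_SUP_iff)
      moreover have "graph_dist G x y \<le> enat n"
        unfolding n[symmetric] graph_diameter_def using xy by (auto intro!: SUP_upper2[of "(x, y)"])
      ultimately have "graph_dist G x y = enat n"
        using n0 by (cases "graph_dist G x y") auto
      then have "y \<in> dist_sphere G x n" using xy by (simp add: dist_sphere_def)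
      moreover obtain f where "graph_automorphism G f" "f x = v"
        using primitive_graph_transitive[OF assms(4) inf xy(1) v] by blast
      ultimately show ?thesis
        using dist_sphere_automorphism[of f x n] xy(1) by (auto simp: bij_betw_def)
    qed
    then obtain p q where pq: "p \<in> dist_sphere G v n" "q \<in> dist_sphere G v n" "p \<noteq> q"
      using primitive_graph_sphere_not_singleton[OF assms(4) inf n0 v] by blast
    \<comment> \<open>The cardinal \<open>a\<close> has to be a relation on \<open>nat\<close>, so
      the sphere is copied into \<open>nat\<close> along the enumeration of the countable vertex
      set.\<close>
    define S where "S = to_nat_on (pverts G) ` dist_sphere G v n"
    have "inj_on (to_nat_on (pverts G)) (dist_sphere G v n)"
      using inj_on_to_nat_on[OF assms(2)] by (rule inj_on_subset) (auto simp: dist_sphere_def)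
    then have bij: "bij_betw (to_nat_on (pverts G)) (dist_sphere G v n) S"
      by (simp add: S_def bij_betw_def)
    \<comment> \<open>\<open>ctwo\<close> is the cardinal of \<open>bool\<close>; two distinct
      points of the sphere give an injection from \<open>bool\<close> into \<open>S\<close>.\<close>
    let ?g = "\<lambda>c. to_nat_on (pverts G) (if c then p else q)"
    have "inj ?g" "range ?g \<subseteq> S"
      using bij pq by (auto simp: bij_betw_def inj_on_def)
    then have "ctwo \<le>o |S|" unfolding ctwo_def card_of_ordLeq[symmetric] by blast
    moreover have "|S| \<le>o natLeq"
      using card_of_mono1[of S UNIV] card_of_nat ordLeq_ordIso_trans by blast
    \<comment> \<open>\<open>S\<close> was built at \<open>v\<close>; an automorphism moving
      \<open>x\<close> to \<open>v\<close> makes it serve every base point.\<close>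
    moreover have "distance_seq G x n =o |S|" if x: "x \<in> pverts G" for x
    proof -
      obtain f where "graph_automorphism G f" "f x = v"
        using primitive_graph_transitive[OF assms(4) inf x v] by blast
      then have "bij_betw f (dist_sphere G x n) (dist_sphere G v n)"
        using dist_sphere_automorphism x by blast
      then show ?thesis
        unfolding distance_seq_eq_card_of using bij card_of_ordIsoI bij_betw_trans by blast
    qed
    ultimately show ?thesis by (intro exI[of _ "|S|"]) (simp add: card_of_Card_order)
  qed
  show ?thesis
  proof (intro conjI impI allI)
    assume "graph_diameter G = \<infinity>"
    then show "\<forall>v\<in>pverts G. distance_seq G v 0 =o cone \<and> (\<forall>i\<ge>1. distance_seq G v i =o natLeq)"
      using zero mid by simp
  next
    fix n assume n: "graph_diameter G = enat n"
    then show "\<exists>a :: nat rel. Card_order a \<and> ctwo \<le>o a \<and> a \<le>o natLeq \<and>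
               (\<forall>v\<in>pverts G.
                  distance_seq G v 0 =o cone \<and>
                  (\<forall>i. 1 \<le> i \<and> i < n \<longrightarrow> distance_seq G v i =o natLeq) \<and>
                  distance_seq G v n =o a)"
      using zero mid last[OF n] by fastforce
  qed
qed

end
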